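(* Let $\mathcal{K}$ and $\mathcal{V}$ satisfy (A0) and (A1) as given in the context, let $V_1,\ldots,V_k$ be $b$-subsemimodules of $\mathcal{V}$, and write $P_i=P_{V_i}$. Suppose that the operator $P_k\cdots P_1$ has an eigenvector $y$ with eigenvalue $\lambda\in\mathcal{K}$. Then $$\lambda=\max_{x^1\in V_1^y,\ldots,x^k\in V_k^y} d_{\mathrm H}(x^1,\ldots,x^k)=d_{\mathrm H}(\bar x^1,\ldots,\bar x^k),$$ where $\bar x^i=P_i\cdots P_1y$ for $i=1,\ldots,k$.
   Context: Setting. A semiring $\mathcal{K}$ (zero $\mathbf{0}$, unit $\mathbf{1}\neq\mathbf{0}$) is idempotent if $a\oplus a=a$ for all $a$. On $\mathcal{K}$ and on a semimodule $\mathcal{V}$ over $\mathcal{K}$ (whose zero is also denoted $\mathbf{0}$), the canonical partial order is $a\le b\Leftrightarrow a\oplus b=b$, so $\oplus$ is the binary supremum. A semiring or semimodule is $b$-complete if every subset bounded from above has a supremum and multiplication distributes over such suprema (for a semimodule: scalar multiplication distributes over suprema of bounded sets of vectors and over suprema of bounded sets of scalars). An idempotent semifield is an idempotent semiring $\mathcal{K}$ in which $\mathcal{K}\setminus\{\mathbf{0}\}$ is an abelian group under multiplication. (A0): $\mathcal{K}$ is a $b$-complete idempotent semifield and $\mathcal{V}$ is a $b$-complete semimodule over $\mathcal{K}$. (A1): for all $x\in\mathcal{V}$ and $y\in\mathcal{V}\setminus\{\mathbf{0}\}$, the set $\{\lambda\in\mathcal{K}\mid\lambda y\le x\}$ is bounded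 from above. For $x\in\mathcal{V}$ and $y\in\mathcal{V}\setminus\{\mathbf{0}\}$ put $x/y=\max\{\lambda\in\mathcal{K}\mid \lambda y\le x\}$ (the maximum exists). A $b$-subsemimodule $V$ of $\mathcal{V}$ is a subsemimodule closed under suprema of its subsets that are bounded from above in $\mathcal{V}$. The projector onto it is $P_V(x)=\max\{u\in V\mid u\le x\}$, $x\in\mathcal{V}$. An eigenvector of $F:\mathcal{V}\to\mathcal{V}$ with eigenvalue $\lambda$ is a nonzero $y$ with $Fy=\lambda y$. For $x\neq\mathbf{0}$, write $x\preceq y$ if $y/x\neq\mathbf{0}$; by convention $\mathbf{0}\preceq y$ for all $y$. For a semimodule $V\subseteq\mathcal{V}$ and $y\in\mathcal{V}$, $V^y=\{x\in V\mid x\preceq y\}$. The Hilbert value of nonzero $x^1,\ldots,x^k\in\mathcal{V}$ is $d_{\mathrm H}(x^1,\ldots,x^k)=(x^1/x^2)(x^2/x^3)\cdots(x^{k-1}/x^k)(x^k/x^1)$; by convention it equals $\mathbf{0}$ if some $x^i=\mathbf{0}$. *)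

theory Defs
  imports Complex_Main
begin

class idempotent_add = comm_monoid_add + ord +
  assumes add_idem: "a + a = a"
    and le_iff_add_eq: "a \<le> b \<longleftrightarrow> a + b = b"
    and less_iff_le_not_le: "a < b \<longleftrightarrow> a \<le> b \<and> \<not> b \<le> a"
begin

subclass order
proof
  fix x y z :: 'a
  show "x < y \<longleftrightarrow> x \<le> y \<and> \<not> y \<le> x"
    by (rule less_iff_le_not_le)
  show "x \<le> x"
    by (simp add: le_iff_add_eq add_idem)
  show "x \<le> z" if "x \<le> y" "y \<le> z"
    using that by (metis le_iff_add_eq add.assoc)
  show "x = y" if "x \<le> y" "y \<le> x"
    using that by (metis le_iff_add_eq add.commute)
qed

definition is_sup :: "'a set \<Rightarrow> 'a \<Rightarrow> bool" where
  "is_sup S s \<longleftrightarrow> (\<forall>x\<in>S. x \<le> s) \<and> (\<forall>u. (\<forall>x\<in>S. x \<le> u) \<longrightarrow> s \<le> u)"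

definition is_max :: "'a set \<Rightarrow> 'a \<Rightarrow> bool" where
  "is_max S m \<longleftrightarrow> m \<in> S \<and> (\<forall>x\<in>S. x \<le> m)"

end

class idempotent_semiring = semiring_1 + idempotent_add

class idempotent_semifield = idempotent_semiring + comm_semiring_1 +
  assumes nonzero_invertible: "a \<noteq> 0 \<Longrightarrow> \<exists>b. a * b = 1"

text \<open>
  Every set that has a supremum is bounded, so distributivity is required exactly for the
  suprema of bounded sets. The empty set is bounded, with supremum \<open>0\<close>.
\<close>

class b_complete_semiring = idempotent_semiring +
  assumes bdd_has_sup: "bdd_above S \<Longrightarrow> \<exists>s. is_sup S s"
    and mult_sup_left: "is_sup S s \<Longrightarrow> is_sup ((\<lambda>b. a * b) ` S) (a * s)"
    and mult_sup_right: "is_sup S s \<Longrightarrow> is_sup ((\<lambda>b. b * a) ` S) (s * a)"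

class b_complete_idempotent_semifield = idempotent_semifield + b_complete_semiring

text \<open>
  Idempotency of the addition of vectors, part of the sort of \<open>'v\<close>, is no additional restriction:
  it follows from \<open>v + v = (1 + 1) v\<close>.
\<close>

locale semimodule =
  fixes scale :: "'k::idempotent_semiring \<Rightarrow> 'v::idempotent_add \<Rightarrow> 'v"
  assumes scale_add_right: "scale a (v + w) = scale a v + scale a w"
    and scale_add_left: "scale (a + b) v = scale a v + scale b v"
    and scale_scale: "scale a (scale b v) = scale (a * b) v"
    and scale_one: "scale 1 v = v"
    and scale_zero_left: "scale 0 v = 0"
    and scale_zero_right: "scale a 0 = 0"

locale b_complete_semimodule = semimodule scale
  for scale :: "'k::b_complete_semiring \<Rightarrow> 'v::idempotent_add \<Rightarrow> 'v" +
  assumes vec_bdd_has_sup: "bdd_above (S :: 'v set) \<Longrightarrow> \<exists>s. is_sup S s"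
    and scale_sup_vec: "is_sup S s \<Longrightarrow> is_sup (scale a ` S) (scale a s)"
    and scale_sup_scalar: "is_sup A c \<Longrightarrow> is_sup ((\<lambda>a. scale a v) ` A) (scale c v)"

definition b_subsemimodule :: "('k \<Rightarrow> 'v::idempotent_add \<Rightarrow> 'v) \<Rightarrow> 'v set \<Rightarrow> bool" where
  "b_subsemimodule scale V \<longleftrightarrow>
     0 \<in> V \<and>
     (\<forall>u\<in>V. \<forall>v\<in>V. u + v \<in> V) \<and>
     (\<forall>a. \<forall>v\<in>V. scale a v \<in> V) \<and>
     (\<forall>S s. S \<subseteq> V \<longrightarrow> bdd_above S \<longrightarrow> is_sup S s \<longrightarrow> s \<in> V)"

text \<open>
  The quotient \<open>x / y\<close>. It is meaningful only for \<open>y \<noteq> 0\<close>; the definitions below never use its value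
  at \<open>y = 0\<close>.
\<close>

definition residual :: "('k::idempotent_semiring \<Rightarrow> 'v::idempotent_add \<Rightarrow> 'v) \<Rightarrow> 'v \<Rightarrow> 'v \<Rightarrow> 'k" where
  "residual scale x y = (GREATEST a. scale a y \<le> x)"

definition projector :: "'v::idempotent_add set \<Rightarrow> 'v \<Rightarrow> 'v" where
  "projector V x = (GREATEST u. u \<in> V \<and> u \<le> x)"

text \<open>\<open>projector_comp V i\<close> is the composition of the projectors onto \<open>V i, \<dots>, V 1\<close>, the one onto \<open>V 1\<close>
  being applied first.\<close>

primrec projector_comp :: "(nat \<Rightarrow> 'v::idempotent_add set) \<Rightarrow> nat \<Rightarrow> 'v \<Rightarrow> 'v" where
  "projector_comp V 0 x = x"
| "projector_comp V (Suc i) x = projector (V (Suc i)) (projector_comp V i x)"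

definition eigenvector ::
    "('k \<Rightarrow> 'v::idempotent_add \<Rightarrow> 'v) \<Rightarrow> ('v \<Rightarrow> 'v) \<Rightarrow> 'k \<Rightarrow> 'v \<Rightarrow> bool" where
  "eigenvector scale F a y \<longleftrightarrow> y \<noteq> 0 \<and> F y = scale a y"

definition preceq ::
    "('k::idempotent_semiring \<Rightarrow> 'v::idempotent_add \<Rightarrow> 'v) \<Rightarrow> 'v \<Rightarrow> 'v \<Rightarrow> bool" where
  "preceq scale x y \<longleftrightarrow> x = 0 \<or> residual scale y x \<noteq> 0"

definition below_part ::
    "('k::idempotent_semiring \<Rightarrow> 'v::idempotent_add \<Rightarrow> 'v) \<Rightarrow> 'v set \<Rightarrow> 'v \<Rightarrow> 'v set" where
  "below_part scale V y = {x \<in> V. preceq scale x y}"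

definition hilbert_value ::
    "('k::idempotent_semifield \<Rightarrow> 'v::idempotent_add \<Rightarrow> 'v) \<Rightarrow> nat \<Rightarrow> (nat \<Rightarrow> 'v) \<Rightarrow> 'k" where
  "hilbert_value scale k x =
     (if \<exists>i\<in>{1..k}. x i = 0 then 0
      else (\<Prod>i\<in>{1..<k}. residual scale (x i) (x (Suc i))) * residual scale (x k) (x 1))"

end

theory Submission
  imports Defs
begin

text \<open>
  If \<open>a x\<^sup>1 \<le> y\<close>, then applying the projectors one after the other gives
  \<open>a (x\<^sup>1/x\<^sup>2) \<cdots> (x\<^sup>i\<^sup>-\<^sup>1/x\<^sup>i) x\<^sup>i \<le> P\<^sub>i \<cdots> P\<^sub>1 y\<close>, because each left-hand side is an element of
  \<open>V\<^sub>i\<close>. Closing the cycle gives \<open>a d x\<^sup>1 \<le> \<lambda> y\<close>, where \<open>d\<close> is the Hilbert value; taking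
  \<open>a = y/x\<^sup>1\<close>, maximality of \<open>a\<close> yields \<open>d \<le> \<lambda>\<close>. For the orbit of \<open>y\<close>, which is decreasing,
  all factors but the last are at least \<open>1\<close>, and the last is at least \<open>\<lambda>\<close>.
\<close>

section \<open>Order and products in idempotent semirings\<close>

lemma zero_le_idempotent: "(0::'a::idempotent_add) \<le> a"
  by (simp add: le_iff_add_eq)

lemma le_zero_idempotent_iff: "(a::'a::idempotent_add) \<le> 0 \<longleftrightarrow> a = 0"
  by (simp add: le_iff_add_eq)

lemma mult_mono_idempotent:
  fixes a b c d :: "'a::idempotent_semiring"
  assumes "a \<le> b" "c \<le> d"
  shows "a * c \<le> b * d"
proof -
  have "a * c \<le> b * c"
    using assms(1) by (simp add: le_iff_add_eq flip: distrib_right)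
  also have "\<dots> \<le> b * d"
    using assms(2) by (simp add: le_iff_add_eq flip: distrib_left)
  finally show ?thesis .
qed

lemma one_le_prod_idempotent:
  fixes f :: "'b \<Rightarrow> 'a::idempotent_semifield"
  assumes "\<And>i. i \<in> A \<Longrightarrow> 1 \<le> f i"
  shows "1 \<le> prod f A"
  using assms
\<comment> \<open>Finiteness is not assumed: over an infinite set \<open>prod\<close> takes the
  default value 1.\<close>
proof (induction A rule: infinite_finite_induct)
  case (insert i A)
  then show ?case
    using mult_mono_idempotent[of 1 "f i" 1 "prod f A"] by simp
qed simp_all

context semimodule
begin

lemma scale_mono_right: "v \<le> w \<Longrightarrow> scale a v \<le> scale a w"
  by (simp add: le_iff_add_eq flip: scale_add_right)

lemma scale_mono_left: "a \<le> b \<Longrightarrow> scale a v \<le> scale b v"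
  by (simp add: le_iff_add_eq flip: scale_add_left)

end

section \<open>Suprema that are attained: projectors and quotients\<close>

context b_complete_semimodule
begin

text \<open>The set is bounded by \<open>x\<close>, so it has a supremum, which is again at most
  \<open>x\<close>; closure of \<open>V\<close> under bounded suprema puts it into \<open>V\<close>.
  This justifies \<open>GREATEST\<close> in \<open>projector\<close>.\<close>

lemma projector_is_max:
  assumes "b_subsemimodule scale V"
  shows "is_max {u \<in> V. u \<le> x} (projector V x)"
proof -
  let ?S = "{u \<in> V. u \<le> x}"
  have bdd: "bdd_above ?S"
    by (auto intro: bdd_aboveI)
  then obtain s where s: "is_sup ?S s"
    using vec_bdd_has_sup by blast
  have closed: "t \<in> V" if "S \<subseteq> V" "bdd_above S" "is_sup S t" for S t
    using assms that unfolding b_subsemimodule_def by simp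
  have "s \<in> V"
    by (rule closed[OF _ bdd s]) auto
  with s have "projector V x = s"
    unfolding projector_def is_sup_def by (intro Greatest_equality) auto
  with s \<open>s \<in> V\<close> show ?thesis
    by (auto simp: is_max_def is_sup_def)
qed

text \<open>Let \<open>c\<close> be the supremum of the admissible scalars. As scaling distributes
  over it, \<open>scale c y\<close> is the supremum of vectors below \<open>x\<close>, so
  \<open>c\<close> is itself admissible.\<close>

lemma residual_is_max:
  assumes "bdd_above {a. scale a y \<le> x}"
  shows "is_max {a. scale a y \<le> x} (residual scale x y)"
proof -
  obtain c where c: "is_sup {a. scale a y \<le> x} c"
    using bdd_has_sup[OF assms] by blast
  have "scale c y \<le> x"
    using scale_sup_scalar[OF c, of y] by (auto simp: is_sup_def)
  with c have "residual scale x y = c"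
    unfolding residual_def is_sup_def by (intro Greatest_equality) auto
  with c \<open>scale c y \<le> x\<close> show ?thesis
    by (auto simp: is_max_def is_sup_def)
qed

end

text \<open>Assumptions (A0) and (A1) together; under them every quotient by a nonzero vector is a
  true maximum.\<close>

locale residuated_semimodule = b_complete_semimodule scale
  for scale :: "'k::b_complete_idempotent_semifield \<Rightarrow> 'v::idempotent_add \<Rightarrow> 'v" +
  assumes bdd_above_quotients: "y \<noteq> 0 \<Longrightarrow> bdd_above {a. scale a y \<le> x}"
begin

lemma scale_residual_le: "y \<noteq> 0 \<Longrightarrow> scale (residual scale x y) y \<le> x"
  using residual_is_max[OF bdd_above_quotients] by (auto simp: is_max_def)

lemma le_residual: "y \<noteq> 0 \<Longrightarrow> scale a y \<le> x \<Longrightarrow> a \<le> residual scale x y"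
  using residual_is_max[OF bdd_above_quotients] by (auto simp: is_max_def)

lemma one_le_residual: "y \<noteq> 0 \<Longrightarrow> y \<le> x \<Longrightarrow> 1 \<le> residual scale x y"
  by (simp add: le_residual scale_one)

text \<open>For nonzero \<open>x\<close> the quotient of \<open>y\<close> by \<open>x\<close> is at
  least 1, hence not 0.\<close>

lemma preceq_if_le: "x \<le> y \<Longrightarrow> preceq scale x y"
  using one_le_residual[of x y] by (auto simp: preceq_def le_zero_idempotent_iff)

text \<open>A nonzero scalar has an inverse, which cancels it.\<close>

lemma scale_eq_zero_iff: "scale a v = 0 \<longleftrightarrow> a = 0 \<or> v = 0"
proof
  assume *: "scale a v = 0"
  show "a = 0 \<or> v = 0"
  proof (cases "a = 0")
    case False
    then obtain b where "b * a = 1"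
      using nonzero_invertible by (metis mult.commute)
    then show ?thesis
      using * by (metis scale_scale scale_one scale_zero_right)
  qed simp
qed (auto simp: scale_zero_left scale_zero_right)

lemma projector_comp_in:
  assumes "\<And>j. j \<in> {1..k} \<Longrightarrow> b_subsemimodule scale (V j)" "i \<in> {1..k}"
  shows "projector_comp V i y \<in> V i"
proof -
  obtain j where "i = Suc j"
    using assms(2) by (cases i) auto
  then show ?thesis
    using projector_is_max[OF assms(1)[OF assms(2)]] by (auto simp: is_max_def)
qed

lemma projector_comp_antimono:
  assumes "\<And>j. j \<in> {1..k} \<Longrightarrow> b_subsemimodule scale (V j)" "i \<le> j" "j \<le> k"
  shows "projector_comp V j y \<le> projector_comp V i y"
  using assms(2,3)
proof (induction j rule: dec_induct)
  case (step j)
  have "projector_comp V (Suc j) y \<le> projector_comp V j y"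
    using projector_is_max[OF assms(1)[of "Suc j"]] step.prems by (auto simp: is_max_def)
  with step show ?case by force
qed simp

section \<open>The eigenvalue bounds all Hilbert values\<close>

lemma scale_prod_residual_le_projector_comp:
  assumes V: "\<And>i. i \<in> {1..k} \<Longrightarrow> b_subsemimodule scale (V i)"
    and x: "\<And>i. i \<in> {1..k} \<Longrightarrow> x i \<in> V i" "\<And>i. i \<in> {1..k} \<Longrightarrow> x i \<noteq> 0"
    and a: "scale a (x 1) \<le> y"
    and j: "1 \<le> j" "j \<le> k"
  shows "scale (a * (\<Prod>i\<in>{1..<j}. residual scale (x i) (x (Suc i)))) (x j) \<le> projector_comp V j y"
proof -
  \<comment> \<open>The scaled vector lies in \<open>V (Suc i)\<close>, so it competes in the
    maximum defining the next projection.\<close>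
  have step: "scale b (x (Suc i)) \<le> projector_comp V (Suc i) y"
    if "scale b (x (Suc i)) \<le> projector_comp V i y" "Suc i \<le> k" for b i
  proof -
    have "b_subsemimodule scale (V (Suc i))" "x (Suc i) \<in> V (Suc i)"
      using V x(1) that(2) by auto
    then show ?thesis
      using projector_is_max[of "V (Suc i)" "projector_comp V i y"] that(1)
      by (auto simp: is_max_def b_subsemimodule_def)
  qed
  show ?thesis
    using j
  proof (induction j rule: nat_induct_at_least)
    case base
    \<comment> \<open>Index 0 is the start \<open>y\<close> of the orbit, and the product over
      \<open>{1..<1}\<close> is empty.\<close>
    then show ?case using step[of a 0] a by simp
  next
    case (Suc j)
    let ?b = "a * (\<Prod>i\<in>{1..<j}. residual scale (x i) (x (Suc i)))"
    let ?r = "residual scale (x j) (x (Suc j))"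
    have "scale (?b * ?r) (x (Suc j)) = scale ?b (scale ?r (x (Suc j)))"
      by (simp add: scale_scale)
    also have "\<dots> \<le> scale ?b (x j)"
      using x(2) Suc.prems by (intro scale_mono_right scale_residual_le) auto
    also have "\<dots> \<le> projector_comp V j y"
      using Suc by simp
    finally show ?case
      using step[of "?b * ?r" j] Suc by (simp add: mult.assoc)
  qed
qed

text \<open>Closes the cycle. By \<open>preceq\<close> the quotient of \<open>y\<close> by
  \<open>x\<close> is invertible, so it may be multiplied onto both sides and cancelled at the
  end.\<close>

lemma le_eigenvalue:
  assumes "x \<noteq> 0" "preceq scale x y"
    and le: "scale (residual scale y x * d) x \<le> scale l y"
  shows "d \<le> l"
proof -
  let ?a = "residual scale y x"
  have "?a \<noteq> 0"
    using assms by (simp add: preceq_def)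
  then obtain b where b: "?a * b = 1"
    using nonzero_invertible by blast
  have "?a * d \<le> ?a * l"
  \<comment> \<open>The main case divides by \<open>l\<close>. If \<open>l\<close> is 0, the
    hypothesis reads \<open>scale (?a * d) x \<le> 0\<close>, and \<open>x\<close> being nonzero
    forces \<open>?a * d\<close> to vanish.\<close>
  proof (cases "l = 0")
    case True
    then show ?thesis
      using le assms(1)
      by (metis le_zero_idempotent_iff scale_zero_left scale_eq_zero_iff zero_le_idempotent)
  next
    case False
    then obtain m where m: "l * m = 1"
      using nonzero_invertible by blast
    have "scale m (scale (?a * d) x) \<le> scale m (scale l y)"
      using le by (rule scale_mono_right)
    also have "\<dots> = y"
      using m by (simp add: scale_scale scale_one mult.commute[of m])
    \<comment> \<open>Here the maximality of the quotient \<open>?a\<close> enters.\<close>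
    finally have "m * (?a * d) \<le> ?a"
      using assms(1) by (intro le_residual) (simp_all add: scale_scale)
    then have "l * (m * (?a * d)) \<le> l * ?a"
      by (rule mult_mono_idempotent[OF order_refl])
    moreover have "l * (m * (?a * d)) = ?a * d"
      using m by (metis mult.assoc mult_1_left)
    ultimately show ?thesis
      by (simp only: mult.commute[of l])
  qed
  then have "b * (?a * d) \<le> b * (?a * l)"
    by (rule mult_mono_idempotent[OF order_refl])
  moreover have "b * (?a * c) = c" for c
    using b by (metis mult.assoc mult.commute mult_1_left)
  ultimately show ?thesis
    by simp
qed

lemma hilbert_value_le_eigenvalue:
  assumes V: "\<And>i. i \<in> {1..k} \<Longrightarrow> b_subsemimodule scale (V i)"
    and k: "1 \<le> k"
    and eig: "projector_comp V k y = scale l y"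
    and x: "\<forall>i\<in>{1..k}. x i \<in> below_part scale (V i) y"
  shows "hilbert_value scale k x \<le> l"
proof (cases "\<exists>i\<in>{1..k}. x i = 0")
  case True
  then show ?thesis
    by (simp add: hilbert_value_def zero_le_idempotent)
next
  case False
  let ?a = "residual scale y (x 1)" and ?r = "residual scale (x k) (x 1)"
  let ?p = "\<Prod>i\<in>{1..<k}. residual scale (x i) (x (Suc i))"
  have x1: "x 1 \<noteq> 0" "preceq scale (x 1) y"
    using False x k by (auto simp: below_part_def)
  have "scale (?a * (?p * ?r)) (x 1) = scale (?a * ?p) (scale ?r (x 1))"
    by (simp add: scale_scale mult.assoc)
  also have "\<dots> \<le> scale (?a * ?p) (x k)"
    using x1 by (intro scale_mono_right scale_residual_le)
  also have "\<dots> \<le> projector_comp V k y"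
    using V x False k scale_residual_le[OF x1(1)]
    by (intro scale_prod_residual_le_projector_comp[where k = k]) (auto simp: below_part_def)
  finally have "?p * ?r \<le> l"
    using le_eigenvalue[OF x1] eig by simp
  with False show ?thesis
    by (simp add: hilbert_value_def)
qed

section \<open>The orbit of \<open>y\<close> attains the bound\<close>

lemma projector_comp_in_below_part:
  assumes V: "\<And>i. i \<in> {1..k} \<Longrightarrow> b_subsemimodule scale (V i)" and i: "i \<in> {1..k}"
  shows "projector_comp V i y \<in> below_part scale (V i) y"
proof -
  have "projector_comp V i y \<le> projector_comp V 0 y"
    using i by (intro projector_comp_antimono[where k = k] V) auto
  then have "preceq scale (projector_comp V i y) y"
    by (intro preceq_if_le) simp
  then show ?thesis
    using projector_comp_in[where V = V and k = k, OF V i] by (simp add: below_part_def)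
qed

lemma eigenvalue_le_hilbert_value:
  assumes V: "\<And>i. i \<in> {1..k} \<Longrightarrow> b_subsemimodule scale (V i)"
    and k: "1 \<le> k"
    and eig: "eigenvector scale (projector_comp V k) l y"
  shows "l \<le> hilbert_value scale k (\<lambda>i. projector_comp V i y)"
\<comment> \<open>The orbit can reach 0 only if \<open>l\<close> is 0, where the bound is trivial.
  Otherwise its last member \<open>scale l y\<close> is nonzero, and so are all the earlier, larger
  ones.\<close>
proof (cases "l = 0")
  case True
  then show ?thesis
    by (simp add: zero_le_idempotent)
next
  case False
  let ?x = "\<lambda>i. projector_comp V i y"
  have xk: "?x k = scale l y" "?x k \<noteq> 0"
    using eig False by (auto simp: eigenvector_def scale_eq_zero_iff)
  have anti: "?x j \<le> ?x i" if "i \<le> j" "j \<le> k" for i j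
    using projector_comp_antimono[OF V that] .
  have nz: "?x i \<noteq> 0" if "i \<le> k" for i
    using anti[OF that] xk(2) by (auto simp: le_zero_idempotent_iff)
  have "1 \<le> (\<Prod>i\<in>{1..<k}. residual scale (?x i) (?x (Suc i)))"
    by (intro one_le_prod_idempotent one_le_residual nz anti) auto
  \<comment> \<open>Since \<open>?x 0\<close> is \<open>y\<close>, scaling
    \<open>?x 1 \<le> y\<close> by \<open>l\<close> gives a vector below \<open>scale l y\<close>,
    which is \<open>?x k\<close>.\<close>
  moreover have "scale l (?x 1) \<le> ?x k"
    using scale_mono_right[OF anti[of 0 1]] k xk(1) by simp
  then have "l \<le> residual scale (?x k) (?x 1)"
    by (intro le_residual nz k)
  ultimately have "1 * l \<le>
      (\<Prod>i\<in>{1..<k}. residual scale (?x i) (?x (Suc i))) * residual scale (?x k) (?x 1)"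
    by (rule mult_mono_idempotent)
  moreover have "\<not> (\<exists>i\<in>{1..k}. ?x i = 0)"
    using nz by auto
  ultimately show ?thesis
    unfolding hilbert_value_def by (simp only: if_False mult_1_left)
qed

end

theorem theorem13:
  fixes scale :: "'k::b_complete_idempotent_semifield \<Rightarrow> 'v::idempotent_add \<Rightarrow> 'v"
    and V :: "nat \<Rightarrow> 'v set" and k :: nat and y :: 'v and l :: 'k
  assumes A0: "b_complete_semimodule scale"
    and A1: "\<And>x y. y \<noteq> 0 \<Longrightarrow> bdd_above {a. scale a y \<le> x}"
    and k: "1 \<le> k"
    and V: "\<And>i. i \<in> {1..k} \<Longrightarrow> b_subsemimodule scale (V i)"
    and eig: "eigenvector scale (projector_comp V k) l y"
  shows "is_max {hilbert_value scale k x | x. \<forall>i\<in>{1..k}. x i \<in> below_part scale (V i) y} l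
    \<and> l = hilbert_value scale k (\<lambda>i. projector_comp V i y)"
proof -
  interpret residuated_semimodule scale
    by (intro residuated_semimodule.intro residuated_semimodule_axioms.intro A0 A1)
  have eq: "projector_comp V k y = scale l y"
    using eig by (simp add: eigenvector_def)
  have bound: "hilbert_value scale k x \<le> l"
    if "\<forall>i\<in>{1..k}. x i \<in> below_part scale (V i) y" for x
    using hilbert_value_le_eigenvalue[OF V k eq that] .
  have mem: "\<forall>i\<in>{1..k}. projector_comp V i y \<in> below_part scale (V i) y"
    by (intro ballI projector_comp_in_below_part[where k = k] V)
  have l: "l = hilbert_value scale k (\<lambda>i. projector_comp V i y)"
    using eigenvalue_le_hilbert_value[OF V k eig] bound[OF mem] by (rule antisym)
  have "l \<in> {hilbert_value scale k x | x. \<forall>i\<in>{1..k}. x i \<in> below_part scale (V i) y}"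
    by (intro CollectI exI[of _ "\<lambda>i. projector_comp V i y"] conjI l mem)
  moreover have "u \<le> l"
    if "u \<in> {hilbert_value scale k x | x. \<forall>i\<in>{1..k}. x i \<in> below_part scale (V i) y}" for u
    using that by (auto intro!: bound)
  ultimately show ?thesis
    unfolding is_max_def using l by (intro conjI ballI)
qed

end
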